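(* Let $(X,G)$ be a minimal dynamical system, where $X$ is a metric space with metric $d$ compatible with its topology. Then the following are equivalent: (a) $(X,G)$ is locally quasi-analytic; (b) the stabilizer URS of $(X,G)$ is a finite set of conjugate subgroups of $G$; (c) there is an almost normal subgroup $H$ of $G$ such that the stabilizers of points with trivial holonomy are conjugates of $H$ in $G$.
   Context: A dynamical system $(X,G)$ is a countable discrete finitely generated group $G$ acting by homeomorphisms on a compact Hausdorff space $X$. It is minimal if $X$ is the only non-empty closed $G$-invariant subset of $X$ (equivalently, every orbit is dense). The stabilizer of $x\in X$ is $G_x=\{g\in G: gx=x\}$. A subgroup $H$ of $G$ is almost normal if its normalizer $N_G(H)$ has finite index in $G$ (equivalently, $H$ has finitely many conjugates in $G$). A point $x\in X$ has trivial holonomy if for every $g\in G_x$ there is an open neighborhood $V$ of $x$ such that $g$ fixes every point of $V$. $S(G)$ is the space of all subgroups of $G$ with the Chabauty--Fell topology, whose basic open sets are $U(A,B)=\{K\in S(G): A\subset K,\ B\cap K=\emptyset\}$ for finite $A,B\subset G$; $G$ acts on $S(G)$ by conjugation. The stabilizer URS of a minimal system $(X,G)$ is the closure in $S(G)$ of $\{G_x : x\in X \text{ has trivial holonomy}\}$; it is the unique minimal closed conjugation-invariant subset of the closure of $\{G_x:x\in X\}$ in $S(G)$. $(X,G)$ is locally quasi-analytic if there is $\epsilon>0$ such that for every open $U\subset X$ with $\mathrm{diam}(U)<\epsilon$ and every $g\in G$: if $g|V=\mathrm{id}$ for some non-empty open $V\subset U$, then $g|U=\mathrm{id}$. *)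

theory Defs
  imports "HOL-Analysis.Analysis" "HOL-Algebra.Group_Action" "HOL-Algebra.Generated_Groups"
begin

text \<open>The acting group carries no topology, which is the same as being discrete. In
  \<^locale>\<open>group_action\<close> each \<open>\<phi> g\<close> is a bijection of the space that takes the value
  \<^const>\<open>undefined\<close> outside it; this only normalises the irrelevant values of \<open>\<phi> g\<close>.\<close>

locale dynamical_system = group_action G "topspace X" \<phi>
  for G :: "('g, 'm) monoid_scheme" (structure)
    and X :: "'x topology"
    and \<phi> :: "'g \<Rightarrow> 'x \<Rightarrow> 'x" +
  assumes countable_group: "countable (carrier G)"
    and finitely_generated: "\<exists>S. finite S \<and> S \<subseteq> carrier G \<and> generate G S = carrier G"
    and compact: "compact_space X"
    and Hausdorff: "Hausdorff_space X"
    and homeomorphisms: "\<And>g. g \<in> carrier G \<Longrightarrow> homeomorphic_map X X (\<phi> g)"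

text \<open>The space itself is one of the non-empty closed invariant sets, so it is non-empty.\<close>

locale minimal_dynamical_system = dynamical_system +
  assumes nonempty: "topspace X \<noteq> {}"
    and minimal: "\<And>A. \<lbrakk>closedin X A; A \<noteq> {}; \<And>g. g \<in> carrier G \<Longrightarrow> \<phi> g ` A \<subseteq> A\<rbrakk>
                    \<Longrightarrow> A = topspace X"

definition trivial_holonomy ::
    "('g, 'm) monoid_scheme \<Rightarrow> 'x topology \<Rightarrow> ('g \<Rightarrow> 'x \<Rightarrow> 'x) \<Rightarrow> 'x \<Rightarrow> bool" where
  "trivial_holonomy G X \<phi> x \<longleftrightarrow>
     (\<forall>g\<in>stabilizer G \<phi> x. \<exists>V. openin X V \<and> x \<in> V \<and> (\<forall>y\<in>V. \<phi> g y = y))"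

definition conjugate_in :: "('g, 'm) monoid_scheme \<Rightarrow> 'g set \<Rightarrow> 'g set \<Rightarrow> bool" where
  "conjugate_in G H K \<longleftrightarrow> (\<exists>g\<in>carrier G. K = g <#\<^bsub>G\<^esub> H #>\<^bsub>G\<^esub> (inv\<^bsub>G\<^esub> g))"

definition almost_normal :: "('g, 'm) monoid_scheme \<Rightarrow> 'g set \<Rightarrow> bool" where
  "almost_normal G H \<longleftrightarrow> subgroup H G \<and> finite (rcosets\<^bsub>G\<^esub> (normalizer G H))"

definition chabauty_basic ::
    "('g, 'm) monoid_scheme \<Rightarrow> 'g set \<Rightarrow> 'g set \<Rightarrow> 'g set set" where
  "chabauty_basic G A B = {K. subgroup K G \<and> A \<subseteq> K \<and> B \<inter> K = {}}"

text \<open>The sets \<open>U(A, B)\<close> satisfy \<open>U(A, B) \<inter> U(A', B') = U(A \<union> A', B \<union> B')\<close> and \<open>U({}, {})\<close>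
  consists of all subgroups, so the topology they generate has them as a base and the space of
  all subgroups as its underlying set.\<close>

definition chabauty_topology :: "('g, 'm) monoid_scheme \<Rightarrow> 'g set topology" where
  "chabauty_topology G =
     topology_generated_by
       {chabauty_basic G A B | A B. finite A \<and> A \<subseteq> carrier G \<and> finite B \<and> B \<subseteq> carrier G}"

definition stabilizer_URS ::
    "('g, 'm) monoid_scheme \<Rightarrow> 'x topology \<Rightarrow> ('g \<Rightarrow> 'x \<Rightarrow> 'x) \<Rightarrow> 'g set set" where
  "stabilizer_URS G X \<phi> =
     chabauty_topology G closure_of
       {stabilizer G \<phi> x | x. x \<in> topspace X \<and> trivial_holonomy G X \<phi> x}"

text \<open>The counterpart of \<^const>\<open>diameter\<close> for a metric given as a function.\<close>

definition mdiameter :: "('x \<Rightarrow> 'x \<Rightarrow> real) \<Rightarrow> 'x set \<Rightarrow> real" where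
  "mdiameter d S = (if S = {} then 0 else SUP (x, y)\<in>S \<times> S. d x y)"

definition locally_quasi_analytic ::
    "('g, 'm) monoid_scheme \<Rightarrow> 'x topology \<Rightarrow> ('x \<Rightarrow> 'x \<Rightarrow> real) \<Rightarrow> ('g \<Rightarrow> 'x \<Rightarrow> 'x) \<Rightarrow> bool" where
  "locally_quasi_analytic G X d \<phi> \<longleftrightarrow>
     (\<exists>\<epsilon>>0. \<forall>U. openin X U \<and> mdiameter d U < \<epsilon> \<longrightarrow>
        (\<forall>g\<in>carrier G.
           (\<exists>V. openin X V \<and> V \<noteq> {} \<and> V \<subseteq> U \<and> (\<forall>y\<in>V. \<phi> g y = y)) \<longrightarrow>
           (\<forall>y\<in>U. \<phi> g y = y)))"

end

theory Submission
  imports Defs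
begin

text \<open>Local quasi-analyticity says that every point has an open neighborhood \<open>U\<close> on which an
  element of the group is the identity as soon as it is the identity on some non-empty open part
  of \<open>U\<close>. The uniform scale \<open>\<epsilon>\<close> of the definition is a Lebesgue number of a cover by such sets
  (\<open>locally_quasi_analytic_iff_nbhds\<close>), so the metric disappears from the rest of the argument.

  (a) implies (b): all points of trivial holonomy in one such \<open>U\<close> have the same stabilizer, namely
  the pointwise stabilizer of \<open>U\<close>. By compactness there are only finitely many of these
  stabilizers, and they are conjugate because each orbit enters each \<open>U\<close>
  (\<open>trivial_holonomy_stabilizers_finite_class\<close>). A finite set of subgroups is closed in the
  Chabauty topology, so it is the stabilizer URS.

  (b) implies (c): the stabilizer of a point with trivial holonomy has all its conjugates in the
  URS, hence only finitely many; by the orbit-stabilizer bijection its normalizer has finite index.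

  (c) implies (a): for each of the finitely many conjugates \<open>K\<close> of \<open>H\<close> let \<open>Y K\<close> be the closed set
  of points fixed by \<open>K\<close>. Points with trivial holonomy are dense by Baire, and each lies in some
  \<open>Y K\<close>, so these sets cover the space. Distinct conjugates in a finite class are never nested, so
  a point with trivial holonomy lies in just one \<open>Y K\<close>, and \<open>K\<close> is then its whole stabilizer. The
  union of all \<open>Y K \<inter> Y L\<close> with \<open>K \<noteq> L\<close> is closed and invariant and misses these points, so it is
  empty by minimality. Therefore the sets \<open>Y K\<close> partition the space into clopen pieces. If \<open>g\<close> is
  the identity on a non-empty open part of \<open>Y K\<close>, that part contains a point with stabilizer \<open>K\<close>, so
  \<open>g \<in> K\<close> and \<open>g\<close> is the identity on \<open>Y K\<close> (\<open>almost_normal_imp_quasi_analytic_nbhd\<close>).\<close>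

section \<open>Conjugates of a subgroup\<close>

context group
begin

lemma conjugate_eq_image: "g <# H #> inv g = (\<lambda>h. g \<otimes> h \<otimes> inv g) ` H"
  unfolding l_coset_def r_coset_def by blast

text \<open>This and \<open>finite_conjugates_iff\<close> reduce facts about conjugates to facts about orbits of the
  conjugation action on all subsets, the action by which the normalizer is defined.\<close>

lemma conjugate_in_iff_orbit:
  assumes "H \<subseteq> carrier G"
  shows "conjugate_in G H K \<longleftrightarrow>
    K \<in> orbit G (\<lambda>g. \<lambda>H \<in> {H. H \<subseteq> carrier G}. g <# H #> inv g) H"
  using assms unfolding conjugate_in_def orbit_def by auto

lemma conjugate_in_subset: "\<lbrakk>H \<subseteq> carrier G; conjugate_in G H K\<rbrakk> \<Longrightarrow> K \<subseteq> carrier G"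
  unfolding conjugate_in_def conjugate_eq_image by auto

lemma conjugate_in_sym:
  assumes "H \<subseteq> carrier G" "conjugate_in G H K"
  shows "conjugate_in G K H"
proof -
  have "K \<subseteq> carrier G"
    using assms by (rule conjugate_in_subset)
  then show ?thesis
    using group_action.orbit_sym[OF action_by_conjugation_on_power_set, of H K]
      conjugate_in_iff_orbit assms by simp
qed

lemma conjugate_in_trans:
  assumes "H \<subseteq> carrier G" "conjugate_in G H K" "conjugate_in G K L"
  shows "conjugate_in G H L"
proof -
  have "K \<subseteq> carrier G" "L \<subseteq> carrier G"
    using assms conjugate_in_subset by blast+
  then show ?thesis
    using group_action.orbit_trans[OF action_by_conjugation_on_power_set, of H K L]
      conjugate_in_iff_orbit assms by simp
qed

lemma finite_conjugates_iff:
  assumes "H \<subseteq> carrier G"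
  shows "finite {K. conjugate_in G H K} \<longleftrightarrow> finite (rcosets (normalizer G H))"
proof -
  let ?\<psi> = "\<lambda>g. \<lambda>H \<in> {H. H \<subseteq> carrier G}. g <# H #> inv g"
  have "bij_betw (\<lambda>R. ?\<psi> (inv (SOME h. h \<in> R)) H) (rcosets (stabilizer G ?\<psi> H)) (orbit G ?\<psi> H)"
    using group_action.orbit_stab_fun_is_bij[OF action_by_conjugation_on_power_set] assms by simp
  moreover have "{K. conjugate_in G H K} = orbit G ?\<psi> H"
    using conjugate_in_iff_orbit[OF assms] by auto
  ultimately show ?thesis
    unfolding normalizer_def using bij_betw_finite by fastforce
qed

text \<open>Conjugation by one element is injective and preserves inclusions, so a strict inclusion could
  be moved until its smaller side is a maximal member of the finite class. In an infinite class a
  subgroup can be properly contained in a conjugate of itself.\<close>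

lemma nested_conjugates_equal:
  assumes H: "H \<subseteq> carrier G" and fin: "finite {K. conjugate_in G H K}"
    and K: "conjugate_in G H K" and L: "conjugate_in G H L" and KL: "K \<subseteq> L"
  shows "K = L"
proof -
  obtain M where M: "conjugate_in G H M"
    and M_max: "\<And>N. conjugate_in G H N \<Longrightarrow> M \<subseteq> N \<Longrightarrow> M = N"
    using finite_has_maximal[OF fin] K by blast
  have "conjugate_in G K M"
    using H K M conjugate_in_sym conjugate_in_trans conjugate_in_subset by metis
  then obtain g where g: "g \<in> carrier G" and gK: "M = g <# K #> inv g"
    unfolding conjugate_in_def by blast
  have "conjugate_in G H (g <# L #> inv g)"
    using conjugate_in_trans[OF H L] g unfolding conjugate_in_def by blast
  moreover have "M \<subseteq> g <# L #> inv g"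
    using KL unfolding gK conjugate_eq_image by blast
  ultimately have "g <# K #> inv g = g <# L #> inv g"
    using M_max gK by blast
  then show ?thesis
    using subgroup_conjugation_is_inj[OF g] conjugate_in_subset[OF H] K L by metis
qed

end

section \<open>Finite sets of subgroups are closed in the Chabauty topology\<close>

lemma chabauty_topspace: "topspace (chabauty_topology G) = {K. subgroup K G}"
proof -
  let ?B = "{chabauty_basic G A B | A B. finite A \<and> A \<subseteq> carrier G \<and> finite B \<and> B \<subseteq> carrier G}"
  have "chabauty_basic G {} {} \<in> ?B"
    by blast
  moreover have "chabauty_basic G {} {} = {K. subgroup K G}"
    unfolding chabauty_basic_def by simp
  ultimately have "{K. subgroup K G} \<in> ?B"
    by simp
  moreover have "W \<subseteq> {K. subgroup K G}" if "W \<in> ?B" for W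
    using that unfolding chabauty_basic_def by blast
  ultimately have "\<Union>?B = {K. subgroup K G}"
    by (intro equalityI Sup_least Sup_upper)
  then show ?thesis
    unfolding chabauty_topology_def by simp
qed

text \<open>Any other subgroup \<open>K\<close> differs from each \<open>L \<in> F\<close> at some element \<open>k L\<close>. The finitely many
  values of \<open>k\<close>, sorted into those inside \<open>K\<close> and those outside, define a basic neighborhood of
  \<open>K\<close> that contains no member of \<open>F\<close>.\<close>

lemma chabauty_closure_of_finite:
  assumes fin: "finite F" and sub: "\<And>L. L \<in> F \<Longrightarrow> subgroup L G"
  shows "chabauty_topology G closure_of F = F"
proof
  let ?B = "{chabauty_basic G A B | A B. finite A \<and> A \<subseteq> carrier G \<and> finite B \<and> B \<subseteq> carrier G}"
  show "F \<subseteq> chabauty_topology G closure_of F"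
    using sub by (intro closure_of_subset) (auto simp: chabauty_topspace)
  show "chabauty_topology G closure_of F \<subseteq> F"
  proof (rule subsetI, rule ccontr)
    fix K assume K: "K \<in> chabauty_topology G closure_of F" and "K \<notin> F"
    then have K_sub: "subgroup K G"
      by (simp add: in_closure_of chabauty_topspace)
    have "\<exists>k. k \<in> carrier G \<and> (k \<in> K) \<noteq> (k \<in> L)" if "L \<in> F" for L
      using that \<open>K \<notin> F\<close> sub K_sub subgroup.subset by (metis subsetD subsetI subset_antisym)
    then obtain k where k: "\<And>L. L \<in> F \<Longrightarrow> k L \<in> carrier G \<and> (k L \<in> K) \<noteq> (k L \<in> L)"
      by metis
    define A where "A = k ` F \<inter> K"
    define B where "B = k ` F - K"
    have "finite A \<and> A \<subseteq> carrier G \<and> finite B \<and> B \<subseteq> carrier G"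
      using fin k unfolding A_def B_def by blast
    then have "chabauty_basic G A B \<in> ?B"
      by blast
    then have "openin (chabauty_topology G) (chabauty_basic G A B)"
      unfolding chabauty_topology_def by (rule topology_generated_by_Basis)
    moreover have "K \<in> chabauty_basic G A B"
      using K_sub unfolding chabauty_basic_def A_def B_def by blast
    ultimately obtain L where "L \<in> F" "L \<in> chabauty_basic G A B"
      using K unfolding in_closure_of by blast
    then show False
      using k[of L] unfolding chabauty_basic_def A_def B_def by blast
  qed
qed

section \<open>Quasi-analytic open sets\<close>

text \<open>The condition that the definition of local quasi-analyticity imposes on one small open set.\<close>

definition quasi_analytic_on ::
    "('g, 'm) monoid_scheme \<Rightarrow> 'x topology \<Rightarrow> ('g \<Rightarrow> 'x \<Rightarrow> 'x) \<Rightarrow> 'x set \<Rightarrow> bool" where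
  "quasi_analytic_on G X \<phi> U \<longleftrightarrow>
     (\<forall>g\<in>carrier G. (\<exists>V. openin X V \<and> V \<noteq> {} \<and> V \<subseteq> U \<and> (\<forall>y\<in>V. \<phi> g y = y)) \<longrightarrow>
        (\<forall>y\<in>U. \<phi> g y = y))"

lemma quasi_analytic_on_subset:
  "\<lbrakk>quasi_analytic_on G X \<phi> W; U \<subseteq> W\<rbrakk> \<Longrightarrow> quasi_analytic_on G X \<phi> U"
  unfolding quasi_analytic_on_def by fast

text \<open>From left to right, small balls are such neighborhoods. From right to left, take for \<open>\<epsilon>\<close> a
  Lebesgue number of the cover by the sets \<open>U\<close>: a set of smaller diameter lies in one of them.\<close>

lemma locally_quasi_analytic_iff_nbhds:
  assumes "Metric_space (topspace X) d" and dX: "Metric_space.mtopology (topspace X) d = X"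
    and comp: "compact_space X"
  shows "locally_quasi_analytic G X d \<phi> \<longleftrightarrow>
    (\<forall>x\<in>topspace X. \<exists>U. openin X U \<and> x \<in> U \<and> quasi_analytic_on G X \<phi> U)"
proof -
  interpret Metric_space "topspace X" d by fact
  have lqa: "locally_quasi_analytic G X d \<phi> \<longleftrightarrow>
    (\<exists>\<epsilon>>0. \<forall>U. openin X U \<and> mdiameter d U < \<epsilon> \<longrightarrow> quasi_analytic_on G X \<phi> U)"
    unfolding locally_quasi_analytic_def quasi_analytic_on_def ..
  \<comment> \<open>The supremum in the diameter is meaningful only because distances are bounded, by
    compactness.\<close>
  have dist_le_mdiameter: "d x y \<le> mdiameter d U" if "x \<in> U" "y \<in> U" "U \<subseteq> topspace X" for x y U
  proof -
    have "compactin mtopology (topspace X)"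
      using comp dX by (simp add: compact_space_def)
    then obtain B where "\<forall>x\<in>topspace X. \<forall>y\<in>topspace X. d x y \<le> B"
      using compactin_imp_mbounded mbounded_alt by blast
    then have "bdd_above ((\<lambda>(x, y). d x y) ` (U \<times> U))"
      using that(3) by (intro bdd_aboveI[of _ B]) auto
    then have "(\<lambda>(x, y). d x y) (x, y) \<le> (SUP (x, y)\<in>U \<times> U. d x y)"
      using that by (intro cSUP_upper) auto
    then show ?thesis
      using that unfolding mdiameter_def by auto
  qed
  show ?thesis
  proof
    assume "locally_quasi_analytic G X d \<phi>"
    then obtain \<epsilon> where \<epsilon>: "\<epsilon> > 0"
      "\<And>U. openin X U \<Longrightarrow> mdiameter d U < \<epsilon> \<Longrightarrow> quasi_analytic_on G X \<phi> U"
      unfolding lqa by blast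
    show "\<forall>x\<in>topspace X. \<exists>U. openin X U \<and> x \<in> U \<and> quasi_analytic_on G X \<phi> U"
    proof
      fix x assume x: "x \<in> topspace X"
      \<comment> \<open>Its diameter is at most \<open>2\<epsilon>/3\<close>; radius \<open>\<epsilon>/2\<close> would not give a strict bound.\<close>
      let ?U = "mball x (\<epsilon>/3)"
      have "x \<in> ?U" "openin X ?U"
        using x \<epsilon> dX openin_mball[of x "\<epsilon>/3"] by auto
      have "?U \<noteq> {}"
        using \<open>x \<in> ?U\<close> by blast
      have "d y z \<le> 2*\<epsilon>/3" if "y \<in> ?U" "z \<in> ?U" for y z
        using that triangle[of y x z] commute[of x y] by simp
      then have "(SUP (x, y)\<in>?U \<times> ?U. d x y) \<le> 2*\<epsilon>/3"
        using \<open>?U \<noteq> {}\<close> by (intro cSUP_least) (auto simp del: mball_eq_empty in_mball)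
      then have "mdiameter d ?U < \<epsilon>"
        using \<epsilon>(1) \<open>?U \<noteq> {}\<close> unfolding mdiameter_def by (simp del: mball_eq_empty)
      with \<open>x \<in> ?U\<close> \<open>openin X ?U\<close> \<epsilon>(2)
      show "\<exists>U. openin X U \<and> x \<in> U \<and> quasi_analytic_on G X \<phi> U" by blast
    qed
  next
    assume nbhds: "\<forall>x\<in>topspace X. \<exists>U. openin X U \<and> x \<in> U \<and> quasi_analytic_on G X \<phi> U"
    let ?\<C> = "{U. openin X U \<and> quasi_analytic_on G X \<phi> U}"
    have "\<exists>\<epsilon>>0. \<forall>x\<in>topspace X. \<exists>U\<in>?\<C>. mball x \<epsilon> \<subseteq> U"
      by (rule lebesgue_number) (use comp nbhds in \<open>auto simp: dX compact_space_def\<close>)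
    then obtain \<epsilon> where "\<epsilon> > 0"
      and \<epsilon>: "\<And>x. x \<in> topspace X \<Longrightarrow> \<exists>W. quasi_analytic_on G X \<phi> W \<and> mball x \<epsilon> \<subseteq> W"
      by blast
    have "quasi_analytic_on G X \<phi> U" if U: "openin X U" "mdiameter d U < \<epsilon>" for U
    proof (cases "U = {}")
      case True
      then show ?thesis unfolding quasi_analytic_on_def by simp
    next
      case False
      then obtain x where x: "x \<in> U" by blast
      have UX: "U \<subseteq> topspace X"
        using U openin_subset by blast
      then have "U \<subseteq> mball x \<epsilon>"
        using x U(2) dist_le_mdiameter[OF x] by fastforce
      then show ?thesis
        using \<epsilon> x UX quasi_analytic_on_subset by (metis order_trans subsetD)
    qed
    then show "locally_quasi_analytic G X d \<phi>"
      unfolding lqa using \<open>\<epsilon> > 0\<close> by blast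
  qed
qed

lemma interior_of_frontier_closed:
  assumes "closedin X F"
  shows "X interior_of (X frontier_of F) = {}"
proof -
  have frontier: "X frontier_of F = F - X interior_of F"
    using assms by (simp add: frontier_of_def closure_of_closedin)
  have "X interior_of (X frontier_of F) \<subseteq> X interior_of F"
    by (rule interior_of_mono) (use frontier in blast)
  then show ?thesis
    using interior_of_subset[of X "X frontier_of F"] frontier by blast
qed

section \<open>Stabilizers of points with trivial holonomy\<close>

lemma (in group_action) stabilizer_translate:
  assumes g: "g \<in> carrier G" and x: "x \<in> E"
  shows "stabilizer G \<phi> (\<phi> g x) = g <# stabilizer G \<phi> x #> inv g"
proof -
  interpret group G
    using group_hom group_hom.axioms(1) by auto
  have gx: "\<phi> g x \<in> E"
    using g x element_image by blast
  show ?thesis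
  proof
    show "stabilizer G \<phi> (\<phi> g x) \<subseteq> g <# stabilizer G \<phi> x #> inv g"
    proof
      fix k assume "k \<in> stabilizer G \<phi> (\<phi> g x)"
      then have k: "k \<in> carrier G" "\<phi> k (\<phi> g x) = \<phi> g x"
        unfolding stabilizer_def by auto
      have "\<phi> (inv g \<otimes> (k \<otimes> g)) x = x"
        using g k x gx orbit_sym_aux[OF g x refl] by (simp add: composition_rule)
      then have "inv g \<otimes> (k \<otimes> g) \<in> stabilizer G \<phi> x"
        using g k unfolding stabilizer_def by simp
      moreover have "k = g \<otimes> (inv g \<otimes> (k \<otimes> g)) \<otimes> inv g"
        using g k by (simp add: m_assoc[symmetric]) (simp add: m_assoc)
      ultimately show "k \<in> g <# stabilizer G \<phi> x #> inv g"
        unfolding conjugate_eq_image by blast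
    qed
    show "g <# stabilizer G \<phi> x #> inv g \<subseteq> stabilizer G \<phi> (\<phi> g x)"
    proof
      fix k assume "k \<in> g <# stabilizer G \<phi> x #> inv g"
      then obtain h where h: "h \<in> carrier G" "\<phi> h x = x" and k: "k = g \<otimes> h \<otimes> inv g"
        unfolding conjugate_eq_image stabilizer_def by auto
      have "\<phi> k (\<phi> g x) = \<phi> g x"
        using g h x gx orbit_sym_aux[OF g x refl] unfolding k by (simp add: composition_rule)
      then show "k \<in> stabilizer G \<phi> (\<phi> g x)"
        using g h unfolding k stabilizer_def by simp
    qed
  qed
qed

context dynamical_system
begin

sublocale group G
  using group_hom group_hom.axioms(1) by auto

lemma closedin_fixed_points:
  assumes "K \<subseteq> carrier G"
  shows "closedin X {x \<in> topspace X. K \<subseteq> stabilizer G \<phi> x}"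
proof -
  have "closedin X {x \<in> topspace X. \<phi> k x = x}" if "k \<in> carrier G" for k
    using closedin_continuous_maps_eq[OF Hausdorff homeomorphic_imp_continuous_map
        [OF homeomorphisms[OF that]], of id] by simp
  then have "closedin X (\<Inter>(insert (topspace X) ((\<lambda>k. {x \<in> topspace X. \<phi> k x = x}) ` K)))"
    using assms by (intro closedin_Inter) auto
  moreover have "{x \<in> topspace X. K \<subseteq> stabilizer G \<phi> x} =
      \<Inter>(insert (topspace X) ((\<lambda>k. {x \<in> topspace X. \<phi> k x = x}) ` K))"
    using assms unfolding stabilizer_def by auto
  ultimately show ?thesis by simp
qed

lemma trivial_holonomy_translate:
  assumes g: "g \<in> carrier G" and x: "x \<in> topspace X" and th: "trivial_holonomy G X \<phi> x"
  shows "trivial_holonomy G X \<phi> (\<phi> g x)"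
  unfolding trivial_holonomy_def
proof
  fix k assume "k \<in> stabilizer G \<phi> (\<phi> g x)"
  then obtain h where h: "h \<in> stabilizer G \<phi> x" and k: "k = g \<otimes> h \<otimes> inv g"
    unfolding stabilizer_translate[OF g x] conjugate_eq_image by blast
  then obtain V where V: "openin X V" "x \<in> V" "\<forall>y\<in>V. \<phi> h y = y"
    using th unfolding trivial_holonomy_def by blast
  have h_carr: "h \<in> carrier G"
    using h stabilizer_subset by blast
  have "\<phi> k (\<phi> g y) = \<phi> g y" if "y \<in> V" for y
  proof -
    have y: "y \<in> topspace X"
      using that V(1) openin_subset by blast
    then show ?thesis
      using g h_carr V(3) that element_image[OF g y refl] orbit_sym_aux[OF g y refl]
      unfolding k by (simp add: composition_rule)
  qed
  moreover have "openin X (\<phi> g ` V)"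
    using homeomorphisms[OF g] V(1) homeomorphic_imp_open_map open_map_def by blast
  ultimately show "\<exists>V. openin X V \<and> \<phi> g x \<in> V \<and> (\<forall>y\<in>V. \<phi> k y = y)"
    using V(2) by (intro exI[of _ "\<phi> g ` V"]) auto
qed

text \<open>A point without trivial holonomy is fixed by some \<open>g\<close> but is not interior to the fixed point
  set of \<open>g\<close>, so it lies on the frontier of that closed set. There are countably many such
  frontiers and none has interior, so Baire's theorem applies.\<close>

lemma trivial_holonomy_dense:
  assumes U: "openin X U" "U \<noteq> {}"
  obtains x where "x \<in> U" "trivial_holonomy G X \<phi> x"
proof -
  define F where "F g = {x \<in> topspace X. {g} \<subseteq> stabilizer G \<phi> x}" for g
  have F: "closedin X (F g)" if "g \<in> carrier G" for g
    using closedin_fixed_points[of "{g}"] that unfolding F_def by simp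
  define N where "N = \<Union>((\<lambda>g. X frontier_of F g) ` carrier G)"
  have "X interior_of N = {}"
    unfolding N_def
  proof (rule Baire_category_alt)
    show "completely_metrizable_space X \<or> locally_compact_space X \<and> regular_space X"
      using compact Hausdorff compact_imp_locally_compact_space compact_Hausdorff_imp_regular_space
      by blast
    show "countable ((\<lambda>g. X frontier_of F g) ` carrier G)"
      using countable_group by simp
    fix T assume "T \<in> (\<lambda>g. X frontier_of F g) ` carrier G"
    then show "closedin X T \<and> X interior_of T = {}"
      using F closedin_frontier_of interior_of_frontier_closed by blast
  qed
  then have "\<not> U \<subseteq> N"
    using U interior_of_maximal by blast
  then obtain x where x: "x \<in> U" "x \<notin> N" by blast
  have xX: "x \<in> topspace X"
    using x U openin_subset by blast
  have "\<exists>V. openin X V \<and> x \<in> V \<and> (\<forall>y\<in>V. \<phi> g y = y)" if g: "g \<in> stabilizer G \<phi> x" for g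
  proof -
    have gc: "g \<in> carrier G"
      using g stabilizer_subset by blast
    have "x \<in> F g"
      using g xX unfolding F_def by simp
    moreover have "x \<notin> X frontier_of F g"
      using x(2) gc unfolding N_def by blast
    ultimately have "x \<in> X interior_of F g"
      using F[OF gc] by (simp add: frontier_of_def closure_of_closedin)
    moreover have "\<forall>y\<in>X interior_of F g. \<phi> g y = y"
      using interior_of_subset[of X "F g"] unfolding F_def stabilizer_def by auto
    ultimately show ?thesis
      using openin_interior_of by blast
  qed
  then show ?thesis
    using that x(1) unfolding trivial_holonomy_def by blast
qed

text \<open>This is where trivial holonomy meets quasi-analyticity: an element fixing \<open>x\<close> fixes a
  neighborhood of \<open>x\<close>, hence all of \<open>U\<close>. So the stabilizer depends on \<open>U\<close> only.\<close>

lemma stabilizer_eq_pointwise_stabilizer: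
  assumes "openin X U" "quasi_analytic_on G X \<phi> U" "x \<in> U" "trivial_holonomy G X \<phi> x"
  shows "stabilizer G \<phi> x = {g \<in> carrier G. \<forall>y\<in>U. \<phi> g y = y}"
proof -
  have "\<forall>y\<in>U. \<phi> g y = y" if g: "g \<in> stabilizer G \<phi> x" for g
  proof -
    obtain V where V: "openin X V" "x \<in> V" "\<forall>y\<in>V. \<phi> g y = y"
      using assms(4) g unfolding trivial_holonomy_def by blast
    have "openin X (V \<inter> U)" "V \<inter> U \<noteq> {}" "V \<inter> U \<subseteq> U" "\<forall>y\<in>V \<inter> U. \<phi> g y = y"
      using V assms by auto
    moreover have "g \<in> carrier G"
      using g stabilizer_subset by blast
    ultimately show ?thesis
      using assms(2) unfolding quasi_analytic_on_def by blast
  qed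
  then show ?thesis
    using assms(3) unfolding stabilizer_def by auto
qed

end

abbreviation trivial_holonomy_stabilizers ::
    "('g, 'm) monoid_scheme \<Rightarrow> 'x topology \<Rightarrow> ('g \<Rightarrow> 'x \<Rightarrow> 'x) \<Rightarrow> 'g set set" where
  "trivial_holonomy_stabilizers G X \<phi> \<equiv>
     {stabilizer G \<phi> x | x. x \<in> topspace X \<and> trivial_holonomy G X \<phi> x}"

section \<open>Finiteness of the class of stabilizers in minimal systems\<close>

context minimal_dynamical_system
begin

text \<open>The points whose orbit avoids \<open>U\<close> form a closed invariant set that is not the whole space.\<close>

lemma orbit_meets_open:
  assumes U: "openin X U" "U \<noteq> {}" and x: "x \<in> topspace X"
  obtains g where "g \<in> carrier G" "\<phi> g x \<in> U"
proof (rule ccontr)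
  assume "\<not> thesis"
  then have avoid: "\<forall>g\<in>carrier G. \<phi> g x \<notin> U"
    using that by blast
  define A where "A = {z \<in> topspace X. \<forall>g\<in>carrier G. \<phi> g z \<in> topspace X - U}"
  have "closedin X {z \<in> topspace X. \<phi> g z \<in> topspace X - U}" if "g \<in> carrier G" for g
    using homeomorphic_imp_continuous_map[OF homeomorphisms[OF that]] U
    by (intro closedin_continuous_map_preimage) auto
  then have "closedin X (\<Inter>((\<lambda>g. {z \<in> topspace X. \<phi> g z \<in> topspace X - U}) ` carrier G))"
    using one_closed by (intro closedin_Inter) blast+
  moreover have "A = \<Inter>((\<lambda>g. {z \<in> topspace X. \<phi> g z \<in> topspace X - U}) ` carrier G)"
    using one_closed unfolding A_def by auto
  ultimately have "closedin X A" by simp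
  moreover have "x \<in> A"
    using x avoid element_image unfolding A_def by blast
  moreover have "\<phi> g ` A \<subseteq> A" if g: "g \<in> carrier G" for g
  proof
    fix y assume "y \<in> \<phi> g ` A"
    then obtain z where z: "z \<in> A" "y = \<phi> g z" by blast
    have zX: "z \<in> topspace X" and zU: "\<And>h. h \<in> carrier G \<Longrightarrow> \<phi> h z \<in> topspace X - U"
      using z unfolding A_def by auto
    have "\<phi> h (\<phi> g z) \<in> topspace X - U" if "h \<in> carrier G" for h
      using zU[of "h \<otimes> g"] g that zX by (simp add: composition_rule)
    then show "y \<in> A"
      using z zU[OF g] unfolding A_def by blast
  qed
  ultimately have "A = topspace X"
    using minimal by blast
  then have "\<phi> \<one> u \<notin> U" if "u \<in> U" for u
    using that U openin_subset unfolding A_def by auto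
  moreover have "\<phi> \<one> u = u" if "u \<in> U" for u
    using that U openin_subset id_eq_one by (metis restrict_apply' subsetD)
  ultimately show False
    using U(2) by force
qed

text \<open>The stabilizers are the pointwise stabilizers of the members of a finite cover. For conjugacy,
  move \<open>x\<close> into a neighborhood \<open>U\<close> of \<open>y\<close>: the moved point and \<open>y\<close> then have equal stabilizers.\<close>

lemma trivial_holonomy_stabilizers_finite_class:
  assumes nbhds: "\<And>x. x \<in> topspace X \<Longrightarrow>
      \<exists>U. openin X U \<and> x \<in> U \<and> quasi_analytic_on G X \<phi> U"
  shows "finite (trivial_holonomy_stabilizers G X \<phi>)"
    and "\<lbrakk>H \<in> trivial_holonomy_stabilizers G X \<phi>; K \<in> trivial_holonomy_stabilizers G X \<phi>\<rbrakk>
      \<Longrightarrow> conjugate_in G H K"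
proof -
  define P where "P U = {g \<in> carrier G. \<forall>y\<in>U. \<phi> g y = y}" for U
  obtain \<F> where \<F>: "finite \<F>" "\<And>U. U \<in> \<F> \<Longrightarrow> openin X U \<and> quasi_analytic_on G X \<phi> U"
    "topspace X \<subseteq> \<Union>\<F>"
  proof -
    have "topspace X \<subseteq> \<Union>{U. openin X U \<and> quasi_analytic_on G X \<phi> U}"
      using nbhds by blast
    then obtain \<F> where "finite \<F>" "\<F> \<subseteq> {U. openin X U \<and> quasi_analytic_on G X \<phi> U}"
      "topspace X \<subseteq> \<Union>\<F>"
      using compact unfolding compact_space_alt by (metis (lifting) mem_Collect_eq)
    then show thesis
      using that by blast
  qed
  have "trivial_holonomy_stabilizers G X \<phi> \<subseteq> P ` \<F>"
  proof
    fix K assume "K \<in> trivial_holonomy_stabilizers G X \<phi>"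
    then obtain x where x: "K = stabilizer G \<phi> x" "x \<in> topspace X" "trivial_holonomy G X \<phi> x"
      by blast
    obtain U where U: "U \<in> \<F>" "x \<in> U"
      using x(2) \<F>(3) by blast
    then have "K = P U"
      using stabilizer_eq_pointwise_stabilizer \<F>(2) x unfolding P_def by blast
    then show "K \<in> P ` \<F>"
      using U by blast
  qed
  then show "finite (trivial_holonomy_stabilizers G X \<phi>)"
    using \<F>(1) finite_surj by blast
  assume "H \<in> trivial_holonomy_stabilizers G X \<phi>" "K \<in> trivial_holonomy_stabilizers G X \<phi>"
  then obtain x y where H: "H = stabilizer G \<phi> x" and K: "K = stabilizer G \<phi> y"
    and x: "x \<in> topspace X" "trivial_holonomy G X \<phi> x"
    and y: "y \<in> topspace X" "trivial_holonomy G X \<phi> y"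
    by blast
  obtain U where U: "openin X U" "y \<in> U" "quasi_analytic_on G X \<phi> U"
    using nbhds y by blast
  then obtain g where g: "g \<in> carrier G" "\<phi> g x \<in> U"
    using orbit_meets_open[of U x] x by blast
  have "stabilizer G \<phi> (\<phi> g x) = K"
    unfolding K
    using stabilizer_eq_pointwise_stabilizer[OF U(1,3) g(2) trivial_holonomy_translate[OF g(1) x]]
      stabilizer_eq_pointwise_stabilizer[OF U(1,3,2) y(2)] by simp
  then show "conjugate_in G H K"
    using g(1) stabilizer_translate[OF g(1) x(1)] unfolding conjugate_in_def H by auto
qed

text \<open>Every conjugate of a stabilizer of trivial holonomy is again one, because trivial holonomy is
  invariant under the action. So finiteness of the set bounds the number of conjugates.\<close>

lemma finite_conjugate_stabilizers_imp_almost_normal: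
  assumes fin: "finite (trivial_holonomy_stabilizers G X \<phi>)"
    and conj: "\<And>H K. \<lbrakk>H \<in> trivial_holonomy_stabilizers G X \<phi>;
      K \<in> trivial_holonomy_stabilizers G X \<phi>\<rbrakk> \<Longrightarrow> conjugate_in G H K"
  shows "\<exists>H. almost_normal G H \<and>
    (\<forall>x\<in>topspace X. trivial_holonomy G X \<phi> x \<longrightarrow> conjugate_in G H (stabilizer G \<phi> x))"
proof -
  obtain x where x: "x \<in> topspace X" "trivial_holonomy G X \<phi> x"
    using trivial_holonomy_dense[of "topspace X"] nonempty by blast
  let ?H = "stabilizer G \<phi> x"
  have "K \<in> trivial_holonomy_stabilizers G X \<phi>" if K: "conjugate_in G ?H K" for K
  proof -
    obtain g where g: "g \<in> carrier G" and "K = g <# ?H #> inv g"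
      using K unfolding conjugate_in_def by blast
    then have "K = stabilizer G \<phi> (\<phi> g x)"
      using stabilizer_translate[OF g x(1)] by simp
    moreover have "\<phi> g x \<in> topspace X"
      using element_image[OF g x(1)] by simp
    ultimately show ?thesis
      using trivial_holonomy_translate[OF g x] by auto
  qed
  then have "{K. conjugate_in G ?H K} \<subseteq> trivial_holonomy_stabilizers G X \<phi>"
    by (intro subsetI) (simp only: mem_Collect_eq)
  then have "finite {K. conjugate_in G ?H K}"
    using fin by (rule finite_subset)
  then have "almost_normal G ?H"
    unfolding almost_normal_def
    using finite_conjugates_iff[OF stabilizer_subset] stabilizer_subgroup[OF x(1)] by blast
  moreover have "conjugate_in G ?H (stabilizer G \<phi> y)"
    if "y \<in> topspace X" "trivial_holonomy G X \<phi> y" for y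
    using conj[of ?H "stabilizer G \<phi> y"] x that by blast
  ultimately show ?thesis
    by blast
qed

text \<open>The neighborhood is the piece, in the partition by fixed point sets of the conjugates of \<open>H\<close>,
  that contains \<open>x\<close>. It is written as the complement of the other pieces to make it open.\<close>

lemma almost_normal_imp_quasi_analytic_nbhd:
  assumes an: "almost_normal G H"
    and conj: "\<And>x. \<lbrakk>x \<in> topspace X; trivial_holonomy G X \<phi> x\<rbrakk>
      \<Longrightarrow> conjugate_in G H (stabilizer G \<phi> x)"
    and x: "x \<in> topspace X"
  shows "\<exists>U. openin X U \<and> x \<in> U \<and> quasi_analytic_on G X \<phi> U"
proof -
  define C where "C = {K. conjugate_in G H K}"
  define Y where "Y K = {x \<in> topspace X. K \<subseteq> stabilizer G \<phi> x}" for K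
  have H: "H \<subseteq> carrier G"
    using an subgroup.subset unfolding almost_normal_def by blast
  have C_fin: "finite C"
    using an finite_conjugates_iff[OF H] unfolding almost_normal_def C_def by blast
  have C_carr: "K \<subseteq> carrier G" if "K \<in> C" for K
    using that H conjugate_in_subset unfolding C_def by blast
  have Y_closed: "closedin X (Y K)" if "K \<in> C" for K
    using closedin_fixed_points C_carr that unfolding Y_def by blast
  \<comment> \<open>The stabilizer is a conjugate of \<open>H\<close> that contains the conjugate \<open>K\<close>.\<close>
  have stab_eq: "stabilizer G \<phi> y = K" if "y \<in> Y K" "K \<in> C" "trivial_holonomy G X \<phi> y" for y K
    using nested_conjugates_equal[OF H C_fin[unfolded C_def], of K "stabilizer G \<phi> y"] that conj
    unfolding C_def Y_def by blast
  have cover: "topspace X \<subseteq> \<Union>(Y ` C)"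
  proof (rule ccontr)
    assume "\<not> topspace X \<subseteq> \<Union>(Y ` C)"
    moreover have "openin X (topspace X - \<Union>(Y ` C))"
      using C_fin Y_closed by (intro openin_diff openin_topspace closedin_Union) auto
    ultimately obtain y where "y \<in> topspace X - \<Union>(Y ` C)" "trivial_holonomy G X \<phi> y"
      using trivial_holonomy_dense by (metis Diff_eq_empty_iff)
    then show False
      using conj unfolding Y_def C_def by blast
  qed
  have disjoint: "Y K \<inter> Y L = {}" if KL: "K \<in> C" "L \<in> C" "K \<noteq> L" for K L
  proof (rule ccontr)
    assume "Y K \<inter> Y L \<noteq> {}"
    \<comment> \<open>A single intersection is not invariant: the group permutes the conjugates.\<close>
    define Z where "Z = \<Union>((\<lambda>(K, L). Y K \<inter> Y L) ` {(K, L) \<in> C \<times> C. K \<noteq> L})"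
    have "Z \<noteq> {}"
      using KL \<open>Y K \<inter> Y L \<noteq> {}\<close> unfolding Z_def by fastforce
    moreover have "closedin X Z"
      unfolding Z_def using C_fin Y_closed
      by (intro closedin_Union) (auto intro: finite_subset[of _ "C \<times> C"])
    moreover have "\<phi> g ` Z \<subseteq> Z" if g: "g \<in> carrier G" for g
    proof
      fix w assume "w \<in> \<phi> g ` Z"
      then obtain z K L where z: "w = \<phi> g z" "z \<in> Y K" "z \<in> Y L" and "K \<in> C" "L \<in> C" "K \<noteq> L"
        unfolding Z_def by auto
      let ?K = "g <# K #> inv g" and ?L = "g <# L #> inv g"
      have "?K \<in> C" "?L \<in> C"
        using \<open>K \<in> C\<close> \<open>L \<in> C\<close> g conjugate_in_trans[OF H] unfolding C_def conjugate_in_def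
        by blast+
      moreover have "?K \<noteq> ?L"
        using subgroup_conjugation_is_inj[OF g] C_carr \<open>K \<in> C\<close> \<open>L \<in> C\<close> \<open>K \<noteq> L\<close> by blast
      moreover have "w \<in> Y (g <# M #> inv g)" if "z \<in> Y M" for M
      proof -
        have zX: "z \<in> topspace X" and M: "M \<subseteq> stabilizer G \<phi> z"
          using that unfolding Y_def by auto
        have "g <# M #> inv g \<subseteq> stabilizer G \<phi> w"
          unfolding z(1) stabilizer_translate[OF g zX] conjugate_eq_image using M by blast
        then show ?thesis
          using element_image[OF g zX] z(1) unfolding Y_def by simp
      qed
      then have "w \<in> Y ?K" "w \<in> Y ?L"
        using z by blast+
      ultimately show "w \<in> Z"
        unfolding Z_def by blast
    qed
    ultimately have "Z = topspace X"
      using minimal by blast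
    moreover obtain y where "y \<in> topspace X" "trivial_holonomy G X \<phi> y"
      using trivial_holonomy_dense[of "topspace X"] nonempty by blast
    ultimately show False
      using stab_eq unfolding Z_def by blast
  qed
  obtain K where K: "K \<in> C" "x \<in> Y K"
    using cover x by blast
  let ?U = "topspace X - \<Union>(Y ` (C - {K}))"
  have U_open: "openin X ?U"
    using C_fin Y_closed by (intro openin_diff openin_topspace closedin_Union) auto
  have xU: "x \<in> ?U"
    using x K disjoint by blast
  have UY: "?U \<subseteq> Y K"
    using cover by blast
  have "quasi_analytic_on G X \<phi> ?U"
    unfolding quasi_analytic_on_def
  proof (intro ballI impI)
    fix g y
    assume g: "g \<in> carrier G" and y: "y \<in> ?U"
      and "\<exists>V. openin X V \<and> V \<noteq> {} \<and> V \<subseteq> ?U \<and> (\<forall>y\<in>V. \<phi> g y = y)"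
    then obtain V where V: "openin X V" "V \<noteq> {}" "V \<subseteq> ?U" "\<forall>y\<in>V. \<phi> g y = y"
      by blast
    obtain v where v: "v \<in> V" "trivial_holonomy G X \<phi> v"
      using trivial_holonomy_dense V by blast
    have "stabilizer G \<phi> v = K"
      using stab_eq v V(3) UY K by blast
    then have "g \<in> K"
      using V(4) v g unfolding stabilizer_def by blast
    then show "\<phi> g y = y"
      using y UY unfolding Y_def stabilizer_def by blast
  qed
  then show ?thesis
    using U_open xU by blast
qed

end

theorem theorem1p5:
  fixes G :: "('g, 'm) monoid_scheme"
    and X :: "'x topology"
    and \<phi> :: "'g \<Rightarrow> 'x \<Rightarrow> 'x"
    and d :: "'x \<Rightarrow> 'x \<Rightarrow> real"
  assumes "minimal_dynamical_system G X \<phi>"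
    and "Metric_space (topspace X) d"
    and "Metric_space.mtopology (topspace X) d = X"
  shows "(locally_quasi_analytic G X d \<phi> \<longleftrightarrow>
            finite (stabilizer_URS G X \<phi>) \<and>
            (\<forall>H\<in>stabilizer_URS G X \<phi>. \<forall>K\<in>stabilizer_URS G X \<phi>. conjugate_in G H K))
       \<and> (locally_quasi_analytic G X d \<phi> \<longleftrightarrow>
            (\<exists>H. almost_normal G H \<and>
               (\<forall>x\<in>topspace X. trivial_holonomy G X \<phi> x \<longrightarrow>
                  conjugate_in G H (stabilizer G \<phi> x))))"
    (is "(?a \<longleftrightarrow> ?b) \<and> (?a \<longleftrightarrow> ?c)")
proof -
  interpret minimal_dynamical_system G X \<phi> by fact
  let ?S = "trivial_holonomy_stabilizers G X \<phi>"
  have sub: "subgroup L G" if "L \<in> ?S" for L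
    using that stabilizer_subgroup by blast
  have a_iff: "?a \<longleftrightarrow> (\<forall>x\<in>topspace X. \<exists>U. openin X U \<and> x \<in> U \<and> quasi_analytic_on G X \<phi> U)"
    using locally_quasi_analytic_iff_nbhds assms(2,3) compact by blast
  have ab: ?b if ?a
  proof -
    have nbhds: "\<And>x. x \<in> topspace X \<Longrightarrow> \<exists>U. openin X U \<and> x \<in> U \<and> quasi_analytic_on G X \<phi> U"
      using that a_iff by blast
    have "finite ?S"
      using trivial_holonomy_stabilizers_finite_class(1)[OF nbhds] .
    moreover from this have "stabilizer_URS G X \<phi> = ?S"
      unfolding stabilizer_URS_def using chabauty_closure_of_finite[of ?S G] sub by blast
    ultimately show ?b
      using trivial_holonomy_stabilizers_finite_class(2)[OF nbhds] by simp
  qed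
  have bc: ?c if ?b
  proof -
    have "?S \<subseteq> topspace (chabauty_topology G)"
      using sub chabauty_topspace by blast
    then have "?S \<subseteq> stabilizer_URS G X \<phi>"
      unfolding stabilizer_URS_def by (rule closure_of_subset)
    moreover from this have "finite ?S"
      using that finite_subset by blast
    ultimately show ?c
      using that by (intro finite_conjugate_stabilizers_imp_almost_normal) (simp, blast)
  qed
  have ca: ?a if ?c
    using that almost_normal_imp_quasi_analytic_nbhd a_iff by blast
  show ?thesis
    using ab bc ca by blast
qed

end
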